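(* Let $a,b,c,d,e,f\in\mathbb{Q}$ with $a\neq 0$ and $d\neq 0$, and for $n\in\mathbb{Z}$ put $$w_n=(an^2+bn+c)F_n+(dn^2+en+f)F_{n-1}.$$ Then $(w_n)$ is an integer sequence (i.e. $w_n\in\mathbb{Z}$ for all $n$) if and only if $f\in\mathbb{Z}$ and there exist integers $z_1,z_2,z_3,z_4,z_5$ such that $$\begin{aligned} a&=\frac{-z_1+3z_2+z_3-3z_4+z_5}{10},\\ b&=\frac{-5z_1-75z_2+15z_3+45z_4-17z_5}{50},\\ c&=\frac{30z_1+30z_2-10z_3-15z_4+6z_5}{25},\\ d&=\frac{3z_1-4z_2-3z_3+4z_4-z_5}{10},\\ e&=\frac{-45z_1+80z_2+15z_3-40z_4+11z_5}{50}. \end{aligned}$$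
   Context: $(F_n)$ is the Fibonacci sequence: $F_0=0$, $F_1=1$, $F_n=F_{n-1}+F_{n-2}$, extended to negative indices by the same recurrence, so that $F_{-n}=(-1)^{n+1}F_n$ (in particular $F_{-1}=1$). *)

theory Defs
  imports "HOL-Number_Theory.Fib"
begin

(* The two-sided Fibonacci sequence; the library constant fib is indexed by naturals only.
   fib_int_rec below confirms that this is the extension by the Fibonacci recurrence. *)
definition fib_int :: "int \<Rightarrow> int" where
  "fib_int n =
     (if n \<ge> 0 then int (fib (nat n))
      else (-1) ^ (nat (- n) + 1) * int (fib (nat (- n))))"

lemma fib_int_of_nat: "fib_int (int n) = int (fib n)"
  by (simp add: fib_int_def)

lemma fib_int_minus_nat: "fib_int (- int n) = (-1) ^ (n + 1) * int (fib n)"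
  by (cases "n = 0") (simp_all add: fib_int_def)

lemma fib_int_initial: "fib_int 0 = 0" "fib_int 1 = 1" "fib_int (-1) = 1"
  by (simp_all add: fib_int_def)

lemma fib_int_rec: "fib_int n = fib_int (n - 1) + fib_int (n - 2)"
proof -
  consider m where "n = int (m + 2)" | "n = 1" | m where "n = - int m"
  proof (cases "n \<ge> 2")
    case True
    then have "n = int (nat (n - 2) + 2)" by simp
    then show ?thesis using that(1) by blast
  next
    case False
    show ?thesis
    proof (cases "n = 1")
      case False
      with \<open>\<not> n \<ge> 2\<close> have "n = - int (nat (- n))" by simp
      then show ?thesis using that(3) by blast
    qed (use that(2) in blast)
  qed
  then show ?thesis
  proof cases
    case (1 m)
    then have "n - 1 = int (m + 1)" "n - 2 = int m" by simp_all
    with 1 show ?thesis by (simp only: fib_int_of_nat) simp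
  next
    case 2
    then show ?thesis by (simp add: fib_int_initial)
  next
    case (3 m)
    then have "n - 1 = - int (m + 1)" "n - 2 = - int (m + 2)" by simp_all
    with 3 show ?thesis by (simp only: fib_int_minus_nat) (simp add: algebra_simps)
  qed
qed

definition w_seq :: "rat \<Rightarrow> rat \<Rightarrow> rat \<Rightarrow> rat \<Rightarrow> rat \<Rightarrow> rat \<Rightarrow> int \<Rightarrow> rat" where
  "w_seq a b c d e f n =
     (a * of_int n ^ 2 + b * of_int n + c) * of_int (fib_int n)
     + (d * of_int n ^ 2 + e * of_int n + f) * of_int (fib_int (n - 1))"

end

theory Submission
  imports Defs
begin

text \<open>
  The sequence is annihilated by \<open>(E\<^sup>2 - E - 1)\<^sup>3\<close> for the shift \<open>E\<close>, an integer polynomial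
  with leading coefficient 1 and constant term -1. Hence all its values are integers iff
  \<open>w\<^sub>0, \<dots>, w\<^sub>5\<close> are. Here \<open>w\<^sub>0 = f\<close>, and the stated formulas invert the linear system
  \<open>z\<^sub>i = w\<^sub>i - f F\<^bsub>i-1\<^esub>\<close> for \<open>i = 1, \<dots>, 5\<close>.
\<close>

text \<open>Each factor E^2 - E - 1 lowers the degree of the polynomial coefficients by one, so its
  cube kills degree 2. The expansion is E^6 - 3 E^5 + 5 E^3 - 3 E - 1.\<close>

lemma w_seq_rec:
  "w_seq a b c d e f (n + 6) =
     3 * w_seq a b c d e f (n + 5) - 5 * w_seq a b c d e f (n + 3)
     + 3 * w_seq a b c d e f (n + 1) + w_seq a b c d e f n"
proof -
  \<comment> \<open>Written through two neighbouring Fibonacci values, all terms turn the claim into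
    a polynomial identity in \<open>n\<close>, \<open>x\<close>, \<open>y\<close> and the
    coefficients.\<close>
  define x y where "x = fib_int n" and "y = fib_int (n - 1)"
  have "fib_int (n + 1) = x + y"
    using fib_int_rec [of "n + 1"] by (simp add: x_def y_def)
  moreover from this have "fib_int (n + 2) = 2 * x + y"
    using fib_int_rec [of "n + 2"] by (simp add: x_def y_def add.commute)
  moreover from calculation have "fib_int (n + 3) = 3 * x + 2 * y"
    using fib_int_rec [of "n + 3"] by (simp add: add.commute)
  moreover from calculation have "fib_int (n + 4) = 5 * x + 3 * y"
    using fib_int_rec [of "n + 4"] by (simp add: add.commute)
  moreover from calculation have "fib_int (n + 5) = 8 * x + 5 * y"
    using fib_int_rec [of "n + 5"] by (simp add: add.commute)
  moreover from calculation have "fib_int (n + 6) = 13 * x + 8 * y"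
    using fib_int_rec [of "n + 6"] by (simp add: add.commute)
  ultimately show ?thesis
    unfolding w_seq_def
    by (simp flip: x_def y_def) (simp add: algebra_simps power2_eq_square)
qed

text \<open>At 0 only \<open>f\<close> survives, by F_0 = 0 and F_{-1} = 1; at 1 the second
  polynomial drops out, again by F_0 = 0.\<close>

lemma w_seq_initial:
  "w_seq a b c d e f 0 = f"
  "w_seq a b c d e f 1 = a + b + c"
  "w_seq a b c d e f 2 = (4 * a + 2 * b + c) + (4 * d + 2 * e + f)"
  "w_seq a b c d e f 3 = 2 * (9 * a + 3 * b + c) + (9 * d + 3 * e + f)"
  "w_seq a b c d e f 4 = 3 * (16 * a + 4 * b + c) + 2 * (16 * d + 4 * e + f)"
  "w_seq a b c d e f 5 = 5 * (25 * a + 5 * b + c) + 3 * (25 * d + 5 * e + f)"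
proof -
  have "fib_int 2 = 1" "fib_int 3 = 2" "fib_int 4 = 3" "fib_int 5 = 5"
    using fib_int_rec [of 2] fib_int_rec [of 3] fib_int_rec [of 4] fib_int_rec [of 5]
    by (simp_all add: fib_int_initial)
  then show
    "w_seq a b c d e f 0 = f"
    "w_seq a b c d e f 1 = a + b + c"
    "w_seq a b c d e f 2 = (4 * a + 2 * b + c) + (4 * d + 2 * e + f)"
    "w_seq a b c d e f 3 = 2 * (9 * a + 3 * b + c) + (9 * d + 3 * e + f)"
    "w_seq a b c d e f 4 = 3 * (16 * a + 4 * b + c) + 2 * (16 * d + 4 * e + f)"
    "w_seq a b c d e f 5 = 5 * (25 * a + 5 * b + c) + 3 * (25 * d + 5 * e + f)"
    by (simp_all add: w_seq_def fib_int_initial)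
qed

lemma w_seq_Ints_iff:
  "(\<forall>n. w_seq a b c d e f n \<in> \<int>) \<longleftrightarrow>
     w_seq a b c d e f 0 \<in> \<int> \<and> w_seq a b c d e f 1 \<in> \<int> \<and> w_seq a b c d e f 2 \<in> \<int> \<and>
     w_seq a b c d e f 3 \<in> \<int> \<and> w_seq a b c d e f 4 \<in> \<int> \<and> w_seq a b c d e f 5 \<in> \<int>"
    (is "_ \<longleftrightarrow> ?initial")
proof
  let ?w = "w_seq a b c d e f"
  \<comment> \<open>The recurrence has order 6, so the induction in both directions carries a window
    of six consecutive values.\<close>
  let ?P = "\<lambda>n. ?w n \<in> \<int> \<and> ?w (n + 1) \<in> \<int> \<and> ?w (n + 2) \<in> \<int> \<and>
    ?w (n + 3) \<in> \<int> \<and> ?w (n + 4) \<in> \<int> \<and> ?w (n + 5) \<in> \<int>"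
  assume ?initial
  have "?P n" for n
  proof (induction n rule: int_induct [where k = 0])
    case base
    show ?case using \<open>?initial\<close> by simp
  next
    case (step1 i)
    then have "?w (i + 6) \<in> \<int>"
      unfolding w_seq_rec by (intro Ints_add Ints_diff Ints_mult Ints_numeral) auto
    with step1 show ?case by (simp add: add.assoc)
  next
    case (step2 i)
    \<comment> \<open>The recurrence at \<open>i - 1\<close>, solved for its last term: that term
      has coefficient 1, so no division occurs.\<close>
    have "?w (i - 1) = ?w (i + 5) - 3 * ?w (i + 4) + 5 * ?w (i + 2) - 3 * ?w i"
      using w_seq_rec [of a b c d e f "i - 1"] by (simp add: algebra_simps)
    also have "\<dots> \<in> \<int>"
      using step2 by (intro Ints_add Ints_diff Ints_mult Ints_numeral) auto
    finally show ?case using step2 by (simp add: algebra_simps)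
  qed
  then show "\<forall>n. ?w n \<in> \<int>" by blast
qed simp

theorem theorem2:
  fixes a b c d e f :: rat
  assumes "a \<noteq> 0" and "d \<noteq> 0"
  shows "(\<forall>n::int. w_seq a b c d e f n \<in> \<int>) \<longleftrightarrow>
    f \<in> \<int> \<and>
    (\<exists>z1 z2 z3 z4 z5 :: int.
      a = of_int (- z1 + 3 * z2 + z3 - 3 * z4 + z5) / 10 \<and>
      b = of_int (- 5 * z1 - 75 * z2 + 15 * z3 + 45 * z4 - 17 * z5) / 50 \<and>
      c = of_int (30 * z1 + 30 * z2 - 10 * z3 - 15 * z4 + 6 * z5) / 25 \<and>
      d = of_int (3 * z1 - 4 * z2 - 3 * z3 + 4 * z4 - z5) / 10 \<and>
      e = of_int (- 45 * z1 + 80 * z2 + 15 * z3 - 40 * z4 + 11 * z5) / 50)"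
    (is "?integral \<longleftrightarrow> f \<in> \<int> \<and> ?param")
proof
  assume ?integral
  then have f: "f \<in> \<int>" using w_seq_initial(1) by metis
  \<comment> \<open>The multiples 0, 1, 1, 2, 3 of \<open>f\<close> are f F_{i-1}; removing them
    leaves five linear forms in \<open>a\<close>, ..., \<open>e\<close>.\<close>
  have "w_seq a b c d e f 1 \<in> \<int>" "w_seq a b c d e f 2 - f \<in> \<int>"
    "w_seq a b c d e f 3 - f \<in> \<int>" "w_seq a b c d e f 4 - 2 * f \<in> \<int>"
    "w_seq a b c d e f 5 - 3 * f \<in> \<int>"
    using \<open>?integral\<close> f by simp_all
  then obtain z1 z2 z3 z4 z5 where
    "a + b + c = of_int z1"
    "(4 * a + 2 * b + c) + (4 * d + 2 * e) = of_int z2"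
    "2 * (9 * a + 3 * b + c) + (9 * d + 3 * e) = of_int z3"
    "3 * (16 * a + 4 * b + c) + 2 * (16 * d + 4 * e) = of_int z4"
    "5 * (25 * a + 5 * b + c) + 3 * (25 * d + 5 * e) = of_int z5"
    unfolding w_seq_initial by (elim Ints_cases) (simp add: algebra_simps)
  \<comment> \<open>Read from right to left, the equations eliminate the z_i, and each formula
    becomes a linear identity in \<open>a\<close>, ..., \<open>e\<close>.\<close>
  note z = this [symmetric]
  have ?param
    by (rule exI [of _ z1], rule exI [of _ z2], rule exI [of _ z3], rule exI [of _ z4],
        rule exI [of _ z5]) (simp add: z field_simps)
  with f show "f \<in> \<int> \<and> ?param" by blast
next
  assume R: "f \<in> \<int> \<and> ?param"
  then obtain z1 z2 z3 z4 z5 :: int where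
    "a = of_int (- z1 + 3 * z2 + z3 - 3 * z4 + z5) / 10"
    "b = of_int (- 5 * z1 - 75 * z2 + 15 * z3 + 45 * z4 - 17 * z5) / 50"
    "c = of_int (30 * z1 + 30 * z2 - 10 * z3 - 15 * z4 + 6 * z5) / 25"
    "d = of_int (3 * z1 - 4 * z2 - 3 * z3 + 4 * z4 - z5) / 10"
    "e = of_int (- 45 * z1 + 80 * z2 + 15 * z3 - 40 * z4 + 11 * z5) / 50"
    by blast
  \<comment> \<open>Substituting the formulas gives back w_i = z_i + f F_{i-1}, an integer because
    \<open>f\<close> is one.\<close>
  then have "w_seq a b c d e f 1 = of_int z1" "w_seq a b c d e f 2 = of_int z2 + f"
    "w_seq a b c d e f 3 = of_int z3 + f" "w_seq a b c d e f 4 = of_int z4 + 2 * f"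
    "w_seq a b c d e f 5 = of_int z5 + 3 * f"
    unfolding w_seq_initial by (simp_all add: field_simps)
  with R show ?integral
    unfolding w_seq_Ints_iff by (simp add: w_seq_initial(1))
qed

end
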